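(* Let $(\mu,P)$ be a time-homogeneous Markov chain on a countable state space $S$ (with $\sigma$-algebra $2^S$), and let $(A_1,B_1),\dots,(A_k,B_k)$ with $A_i,B_i\subseteq S$ be a Streett acceptance condition such that $$\mathsf P_\mu\Big(\bigcap_{i=1}^k\mathrm{Fin}(A_i)\cup\mathrm{Inf}(B_i)\Big)=p$$ for some $p\in(0,1]$. Then for every $\varepsilon>0$ there exist: - $I\subseteq S$; - $V_0:S\to\mathbb R_{\ge0}$ with $\mu V_0\le1-p+\varepsilon$; - $J_i\subseteq I\setminus A_i$; - $V_i,W_i:S\to\mathbb R_{\ge0}$; - $d_i:\mathbb R_{\ge0}\to\mathbb R_{>0}$; - $p_i:\mathbb R_{\ge0}\to(0,1]$ ($i=1,\dots,k$); such that, for every $i=1,\dots,k$: 1. $\forall s\notin A_i$: $PV_i(s)\le V_i(s)$; 2. $\forall s\in A_i$: $V_i(s)\ge1$; 3. $\exists\gamma_i>0\ \forall s\in J_i$: $V_i(s)\le1-\gamma_i$; 4. $\forall s\in I\setminus(B_i\cup J_i)$: $W_i(s)>0$ and $PW_i(s)\le W_i(s)$; 5. $\forall s\in I\cap(B_i\cup J_i)$: $W_i(s)=0$; 6. $\forall r>0\ \forall s\in I\setminus(B_i\cup J_i)$: if $W_i(s)=r$ then $P(s,\{s':W_i(s')\le r-d_i(r)\})\ge p_i(r)$; 7. $p_i$ and $d_i$ are non-increasing on $\mathbb R_{>0}$; and moreover $\forall s\in I$: $PV_0(s)\le V_0(s)$, and $\forall s\notin I$: $V_0(s)\ge1$.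
   Context: Setting. - $\mathsf P_\mu$ is the law on $S^\omega$ of the time-homogeneous Markov chain $(\Phi_n)$ with initial distribution $\mu$ and kernel $P$. - $\mathrm{Fin}(A)=\bigcup_{n}\bigcap_{m\ge n}\{\Phi_m\notin A\}$ and $\mathrm{Inf}(A)=\bigcap_n\bigcup_{m\ge n}\{\Phi_m\in A\}$. Notation. $PV(s)=\sum_u V(u)P(s,\{u\})$ and $\mu V=\sum_s V(s)\mu(\{s\})$. *)

theory Defs
  imports "HOL-Probability.Probability"
begin

text \<open>
  On a countable state space with the full powerset as sigma-algebra, probability measures are
  exactly pmfs: a Markov chain is an initial distribution \<open>\<mu>\<close> and a kernel \<open>P\<close> with
  \<open>P(s, X) = measure_pmf.prob (P s) X\<close> and \<open>P(s, {u}) = pmf (P s) u\<close>.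
\<close>

definition chain_step :: "'s pmf \<Rightarrow> ('s \<Rightarrow> 's pmf) \<Rightarrow> nat \<Rightarrow> (nat \<Rightarrow> 's) \<Rightarrow> 's measure" where
  "chain_step \<mu> P n \<omega> = measure_pmf (case n of 0 \<Rightarrow> \<mu> | Suc m \<Rightarrow> P (\<omega> m))"

lemma Ionescu_Tulcea_chain_step:
  "Ionescu_Tulcea (chain_step \<mu> P) (\<lambda>_. count_space UNIV)"
proof (rule Ionescu_Tulcea.intro)
  fix i :: nat
  show "chain_step \<mu> P i \<in> measurable (PiM {0..<i} (\<lambda>_. count_space UNIV))
      (subprob_algebra (count_space UNIV))"
  proof (cases i)
    case 0
    then show ?thesis
      by (simp add: chain_step_def[abs_def] measure_pmf_in_subprob_algebra)
  next
    case (Suc m)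
    have "(\<lambda>\<omega>. \<omega> m) \<in> measurable (PiM {0..<i} (\<lambda>_. count_space UNIV)) (count_space UNIV)"
      by (rule measurable_component_singleton) (simp add: Suc)
    then have "(\<lambda>\<omega>. measure_pmf (P (\<omega> m))) \<in> measurable (PiM {0..<i} (\<lambda>_. count_space UNIV))
        (subprob_algebra (count_space UNIV))"
      by (rule measurable_compose) (simp add: measure_pmf_in_subprob_algebra)
    then show ?thesis
      by (simp add: chain_step_def[abs_def] Suc)
  qed
qed (simp add: chain_step_def prob_space_measure_pmf)

text \<open>The law of the chain on \<open>S\<^sup>\<omega>\<close> (product sigma-algebra), by the Ionescu-Tulcea theorem.\<close>

definition chain_law :: "'s pmf \<Rightarrow> ('s \<Rightarrow> 's pmf) \<Rightarrow> (nat \<Rightarrow> 's) measure" where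
  "chain_law \<mu> P = projective_family.lim UNIV
     (Ionescu_Tulcea.CI (chain_step \<mu> P) (\<lambda>_. count_space UNIV)) (\<lambda>_. count_space UNIV)"

lemma sets_chain_law [measurable_cong]:
  "sets (chain_law \<mu> P) = sets (PiM UNIV (\<lambda>_. count_space UNIV))"
proof -
  interpret IT: Ionescu_Tulcea "chain_step \<mu> P" "\<lambda>_. count_space UNIV"
    by (rule Ionescu_Tulcea_chain_step)
  show ?thesis
    unfolding chain_law_def by (rule IT.PF.sets_lim)
qed

lemma space_chain_law [simp]: "space (chain_law \<mu> P) = UNIV"
  using sets_eq_imp_space_eq[OF sets_chain_law[of \<mu> P]] by (simp add: space_PiM)

lemma emeasure_chain_law_cylinder:
  "emeasure (chain_law \<mu> P) {\<omega>. \<forall>i\<le>n. \<omega> i = s i} =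
     ennreal (pmf \<mu> (s 0) * (\<Prod>i<n. pmf (P (s i)) (s (Suc i))))"
proof -
  let ?M = "\<lambda>_::nat. count_space (UNIV :: 'a set)"
  interpret IT: Ionescu_Tulcea "chain_step \<mu> P" ?M
    by (rule Ionescu_Tulcea_chain_step)
  let ?X = "\<lambda>n. (\<Pi>\<^sub>E i\<in>{0..<n}. {s i})"
  let ?C = "\<lambda>n. IT.C 0 n (\<lambda>_. undefined)"
  have X_sets: "?X n \<in> sets (PiM {0..<n} ?M)" for n
    by (rule sets_PiM_I_finite) auto
  have u: "(\<lambda>_. undefined) \<in> space (PiM {0..<0} ?M)"
    by (simp add: space_PiM)
  have step: "emeasure (?C (Suc n)) (?X (Suc n)) =
      emeasure (?C n) (?X n) * emeasure (chain_step \<mu> P n s) {s n}" for n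
  proof -
    have sp: "space (?C n) = space (PiM {0..<n} ?M)"
      using IT.space_C[OF u, of n] by simp
    have st: "sets (?C n) = sets (PiM {0..<n} ?M)"
      using IT.sets_C[OF u, of n] by simp
    have "emeasure (?C (Suc n)) (?X (Suc n)) = (\<integral>\<^sup>+\<omega>. emeasure (IT.eP n \<omega>) (?X (Suc n)) \<partial>?C n)"
      using IT.measurable_eP[of n] X_sets[of "Suc n"]
      by (simp, subst emeasure_bind[where N = "PiM {0..<Suc n} ?M"])
         (auto simp: sp space_PiM measurable_cong_sets[OF st refl] PiE_eq_empty_iff)
    also have "\<dots> = (\<integral>\<^sup>+\<omega>. emeasure (chain_step \<mu> P n s) {s n} * indicator (?X n) \<omega> \<partial>?C n)"
    proof (rule nn_integral_cong)
      fix \<omega> assume w: "\<omega> \<in> space (?C n)"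
      then have w': "\<omega> \<in> space (PiM {0..<n} ?M)" by (simp add: sp)
      have e: "emeasure (IT.eP n \<omega>) (?X (Suc n)) =
          emeasure (chain_step \<mu> P n \<omega>) (fun_upd \<omega> n -` ?X (Suc n))"
        using IT.emeasure_eP[OF w' X_sets[of "Suc n"]] by simp
      show "emeasure (IT.eP n \<omega>) (?X (Suc n)) =
          emeasure (chain_step \<mu> P n s) {s n} * indicator (?X n) \<omega>"
      proof (cases "\<omega> \<in> ?X n")
        case True
        have "chain_step \<mu> P n \<omega> = chain_step \<mu> P n s"
          using True by (cases n) (auto simp: chain_step_def PiE_iff)
        moreover have "fun_upd \<omega> n -` ?X (Suc n) = {s n}"
          using True by (auto simp: PiE_iff extensional_def atLeastLessThanSuc)
        ultimately show ?thesis using True e by simp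
      next
        case False
        have "fun_upd \<omega> n -` ?X (Suc n) = {}"
        proof (rule ccontr)
          assume "fun_upd \<omega> n -` ?X (Suc n) \<noteq> {}"
          then obtain x where x: "fun_upd \<omega> n x \<in> ?X (Suc n)" by auto
          have "\<omega> i = s i" if "i < n" for i
            using x that by (auto simp: PiE_iff dest!: bspec[of _ _ i])
          then have "\<omega> \<in> ?X n"
            using w' by (auto simp: PiE_iff space_PiM)
          with False show False by simp
        qed
        then show ?thesis using False e by simp
      qed
    qed
    also have "\<dots> = emeasure (?C n) (?X n) * emeasure (chain_step \<mu> P n s) {s n}"
      using X_sets[of n] by (subst nn_integral_cmult_indicator) (simp_all add: st mult.commute)
    finally show ?thesis .
  qed
  have C: "emeasure (?C (Suc n)) (?X (Suc n)) =
      ennreal (pmf \<mu> (s 0) * (\<Prod>i<n. pmf (P (s i)) (s (Suc i))))" for n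
  proof (induction n)
    case 0
    show ?case
      unfolding step by (simp add: chain_step_def emeasure_pmf_single sets_PiM_empty)
  next
    case (Suc n)
    show ?case
      unfolding step[of "Suc n"] Suc.IH
      by (simp add: chain_step_def emeasure_pmf_single ennreal_mult'[symmetric] mult.assoc
          prod_nonneg)
  qed
  have "{\<omega>. \<forall>i\<le>n. \<omega> i = s i} = prod_emb UNIV ?M {0..<Suc n} (?X (Suc n))"
    by (auto simp: prod_emb_def PiE_iff less_Suc_eq_le)
  then have "emeasure (chain_law \<mu> P) {\<omega>. \<forall>i\<le>n. \<omega> i = s i} =
      emeasure (IT.CI {0..<Suc n}) (?X (Suc n))"
    unfolding chain_law_def using IT.lim[OF _ X_sets[of "Suc n"]] by simp
  also have "\<dots> = emeasure (?C (Suc n)) (?X (Suc n))"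
    using IT.emeasure_CI[OF subset_refl X_sets[of "Suc n"]] by (simp add: prod_emb_id PiE_iff subset_eq)
  finally show ?thesis
    using C by simp
qed

definition Fin :: "'s set \<Rightarrow> (nat \<Rightarrow> 's) set" where
  "Fin A = (\<Union>n. \<Inter>m\<in>{n..}. {\<omega>. \<omega> m \<notin> A})"

definition Inf_often :: "'s set \<Rightarrow> (nat \<Rightarrow> 's) set" where
  "Inf_often A = (\<Inter>n. \<Union>m\<in>{n..}. {\<omega>. \<omega> m \<in> A})"

text \<open>
  For nonnegative \<open>V\<close>, \<open>wsum (P s) V\<close> is \<open>PV(s)\<close> and \<open>wsum \<mu> V\<close> is \<open>\<mu>V\<close>. The value lies in
  \<open>[0, \<infinity>]\<close>, so that a bound \<open>wsum D V \<le> ennreal c\<close> includes finiteness of the series.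
\<close>

definition wsum :: "'s pmf \<Rightarrow> ('s \<Rightarrow> real) \<Rightarrow> ennreal" where
  "wsum D V = (\<Sum>\<^sub>\<infinity>u. ennreal (V u * pmf D u))"

lemma wsum_eq_nn_integral:
  fixes D :: "'s::countable pmf"
  assumes "\<And>u. 0 \<le> V u"
  shows "wsum D V = (\<integral>\<^sup>+u. ennreal (V u) \<partial>measure_pmf D)"
proof -
  let ?f = "\<lambda>u. ennreal (V u * pmf D u)"
  let ?F = "\<lambda>n. {u :: 's. to_nat u < n}"
  have fin: "finite (?F n)" for n
    using finite_vimageI[OF finite_lessThan[of n] inj_to_nat] by (simp add: vimage_def)
  have S: "wsum D V = (SUP F\<in>{F. finite F}. sum ?f F)"
    unfolding wsum_def by (subst nonneg_infsum_complete) simp_all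
  have part: "(\<integral>\<^sup>+u. ?f u * indicator F u \<partial>count_space UNIV) = sum ?f F" if "finite F" for F
    using that
    by (simp add: nn_integral_count_space_indicator[symmetric] nn_integral_count_space_finite)
  have "(\<integral>\<^sup>+u. ennreal (V u) \<partial>measure_pmf D) = (\<integral>\<^sup>+u. ?f u \<partial>count_space UNIV)"
    by (simp add: nn_integral_measure_pmf ennreal_mult assms mult.commute)
  also have "\<dots> = (\<integral>\<^sup>+u. (SUP n. ?f u * indicator (?F n) u) \<partial>count_space UNIV)"
  proof (rule nn_integral_cong)
    fix u :: 's
    show "?f u = (SUP n. ?f u * indicator (?F n) u)"
      by (rule antisym)
         (auto intro!: SUP_upper2[of "Suc (to_nat u)"] SUP_least split: split_indicator)
  qed
  also have "\<dots> = (SUP n. \<integral>\<^sup>+u. ?f u * indicator (?F n) u \<partial>count_space UNIV)"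
    by (rule nn_integral_monotone_convergence_SUP)
       (auto simp: incseq_def le_fun_def split: split_indicator)
  also have "\<dots> = (SUP n. sum ?f (?F n))"
    using part[OF fin] by simp
  finally have N: "(\<integral>\<^sup>+u. ennreal (V u) \<partial>measure_pmf D) = (SUP n. sum ?f (?F n))" .
  have N': "(\<integral>\<^sup>+u. ennreal (V u) \<partial>measure_pmf D) = (\<integral>\<^sup>+u. ?f u \<partial>count_space UNIV)"
    by (simp add: nn_integral_measure_pmf ennreal_mult assms mult.commute)
  show ?thesis
  proof (rule antisym)
    show "wsum D V \<le> (\<integral>\<^sup>+u. ennreal (V u) \<partial>measure_pmf D)"
      unfolding S
    proof (rule SUP_least)
      fix F :: "'s set" assume "F \<in> {F. finite F}"
      then have "sum ?f F = (\<integral>\<^sup>+u. ?f u * indicator F u \<partial>count_space UNIV)"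
        using part by simp
      also have "\<dots> \<le> (\<integral>\<^sup>+u. ?f u \<partial>count_space UNIV)"
        by (rule nn_integral_mono) (simp split: split_indicator)
      finally show "sum ?f F \<le> (\<integral>\<^sup>+u. ennreal (V u) \<partial>measure_pmf D)"
        unfolding N' .
    qed
    show "(\<integral>\<^sup>+u. ennreal (V u) \<partial>measure_pmf D) \<le> wsum D V"
      unfolding N S using fin by (intro SUP_least SUP_upper) simp
  qed
qed

end

theory Submission
  imports Defs
begin

text \<open>
  Let \<open>a s\<close> be the probability that the chain from \<open>s\<close> satisfies the Streett condition. Then \<open>a\<close>
  is harmonic, \<open>I = {s. \<delta> \<le> a s}\<close> and \<open>V\<^sub>0 = (1 - a) / (1 - \<delta>)\<close> for small \<open>\<delta>\<close>. For a pair \<open>(A, B)\<close>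
  let \<open>V s\<close> be the probability of reaching \<open>A\<close> from \<open>s\<close>, and \<open>J = {s \<in> I. V s \<le> 1/2}\<close>.

  The set \<open>C = I - (B \<union> J)\<close> is left almost surely. Indeed, if staying in a set has positive
  probability, then its probability is arbitrarily close to 1 at some states of that set. As \<open>A\<close>
  is reached with probability above \<open>1/2\<close> throughout \<open>C\<close>, staying in \<open>C - A\<close> is therefore null, so
  almost no path that stays in \<open>C\<close> avoids \<open>A\<close> eventually. Hence almost no such path satisfies the
  acceptance condition, which has probability at least \<open>\<delta>\<close> throughout \<open>C\<close>, and staying in \<open>C\<close> is
  null as well.

  Since \<open>C\<close> is left almost surely, the probability of meeting a state of index \<open>\<ge> n\<close> before leaving
  tends to 0 as \<open>n\<close> grows, so these probabilities are summable along a subsequence. Their sum is a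
  supermartingale on \<open>C\<close> with finite sublevel sets. Adding a discounted survival probability makes
  the drift strict, so every state of \<open>C\<close> has a successor of smaller value, and \<open>d\<close> and the success
  probabilities are minima over the finite sublevel sets.
\<close>

subsection \<open>Expectations of nonnegative functions\<close>

context
  fixes D :: "'s::countable pmf"
begin

lemma wsum_mono:
  assumes "\<And>u. 0 \<le> f u" "\<And>u. f u \<le> g u"
  shows "wsum D f \<le> wsum D g"
proof -
  have "0 \<le> g u" for u
    using assms[of u] by linarith
  then show ?thesis
    using assms by (simp add: wsum_eq_nn_integral nn_integral_mono ennreal_leI)
qed

lemma wsum_add:
  assumes "\<And>u. 0 \<le> f u" "\<And>u. 0 \<le> g u"
  shows "wsum D (\<lambda>u. f u + g u) = wsum D f + wsum D g"
  using assms by (simp add: wsum_eq_nn_integral nn_integral_add)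

lemma wsum_cmult:
  assumes "0 \<le> c" "\<And>u. 0 \<le> f u"
  shows "wsum D (\<lambda>u. c * f u) = ennreal c * wsum D f"
  using assms by (simp add: wsum_eq_nn_integral ennreal_mult nn_integral_cmult)

lemma wsum_suminf:
  assumes "\<And>n u. 0 \<le> f n u" "\<And>u. summable (\<lambda>n. f n u)"
  shows "wsum D (\<lambda>u. \<Sum>n. f n u) = (\<Sum>n. wsum D (f n))"
proof -
  have "wsum D (\<lambda>u. \<Sum>n. f n u) = (\<integral>\<^sup>+u. (\<Sum>n. ennreal (f n u)) \<partial>D)"
    using assms by (simp add: wsum_eq_nn_integral suminf_nonneg suminf_ennreal2)
  also have "\<dots> = (\<Sum>n. wsum D (f n))"
    using assms by (simp add: nn_integral_suminf wsum_eq_nn_integral)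
  finally show ?thesis .
qed

lemma wsum_suminf_le:
  assumes "\<And>n u. 0 \<le> f n u" "\<And>u. summable (\<lambda>n. f n u)"
    and "\<And>n. 0 \<le> c n" "summable c" "\<And>n. wsum D (f n) \<le> ennreal (c n)"
  shows "wsum D (\<lambda>u. \<Sum>n. f n u) \<le> ennreal (\<Sum>n. c n)"
proof -
  have "wsum D (\<lambda>u. \<Sum>n. f n u) \<le> (\<Sum>n. ennreal (c n))"
    unfolding wsum_suminf[OF assms(1,2)] using assms(5) by (intro suminf_le) auto
  also have "\<dots> = ennreal (\<Sum>n. c n)"
    using assms(3,4) by (rule suminf_ennreal2)
  finally show ?thesis .
qed

lemma wsum_less_imp_ex_less:
  assumes "\<And>u. 0 \<le> f u" "wsum D f < ennreal c"
  shows "\<exists>x\<in>set_pmf D. f x < c"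
proof (rule ccontr)
  assume "\<not> ?thesis"
  then have "(\<integral>\<^sup>+u. ennreal c \<partial>D) \<le> (\<integral>\<^sup>+u. ennreal (f u) \<partial>D)"
    by (intro nn_integral_mono_AE) (auto simp: AE_measure_pmf_iff not_less intro!: ennreal_leI)
  then show False
    using assms by (simp add: wsum_eq_nn_integral)
qed

end

lemma summable_subsequence_of_tendsto_0:
  fixes w :: "nat \<Rightarrow> 'a::countable \<Rightarrow> 'b::banach"
  assumes "\<And>x. (\<lambda>n. w n x) \<longlonglongrightarrow> 0"
  shows "\<exists>N. \<forall>x. summable (\<lambda>j. w (N j) x)"
proof -
  have "\<exists>n. \<forall>x. to_nat x \<le> j \<longrightarrow> norm (w n x) \<le> (1/2)^j" for j
  proof -
    have "\<forall>\<^sub>F n in sequentially. norm (w n x) < (1/2)^j" for x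
      using tendsto_norm_zero[OF assms] by (rule order_tendstoD) simp
    then have "\<forall>\<^sub>F n in sequentially. \<forall>x\<in>to_nat -` {..j}. norm (w n x) < (1/2)^j"
      by (simp add: eventually_ball_finite finite_vimageI inj_to_nat)
    then obtain n where "\<forall>x\<in>to_nat -` {..j}. norm (w n x) < (1/2)^j"
      using eventually_happens'[OF sequentially_bot] by blast
    then show ?thesis
      by (intro exI[of _ n]) (simp add: less_imp_le)
  qed
  then obtain N where N: "\<And>j x. to_nat x \<le> j \<Longrightarrow> norm (w (N j) x) \<le> (1/2)^j"
    by metis
  have "summable (\<lambda>j. w (N j) x)" for x
    by (rule summable_comparison_test'[where g = "\<lambda>j. (1/2)^j" and N = "to_nat x"])
       (simp_all add: N summable_geometric)
  then show ?thesis by blast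
qed

lemma finite_sublevel_suminf:
  fixes f :: "nat \<Rightarrow> 'a \<Rightarrow> real"
  assumes "\<And>n x. 0 \<le> f n x" "\<And>x. summable (\<lambda>n. f n x)" "\<And>n. finite {x\<in>C. f n x < 1}"
  shows "finite {x\<in>C. (\<Sum>n. f n x) \<le> r}"
proof -
  obtain K :: nat where "r < real K"
    using reals_Archimedean2 by blast
  have "\<exists>n<K. f n x < 1" if "(\<Sum>n. f n x) \<le> r" for x
  proof (rule ccontr)
    assume "\<not> ?thesis"
    then have "(\<Sum>n<K. 1) \<le> (\<Sum>n<K. f n x)"
      by (intro sum_mono) (meson lessThan_iff not_less)
    also have "\<dots> \<le> (\<Sum>n. f n x)"
      using assms(1,2) by (intro sum_le_suminf) auto
    finally show False
      using that \<open>r < real K\<close> by simp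
  qed
  then have "{x\<in>C. (\<Sum>n. f n x) \<le> r} \<subseteq> (\<Union>n<K. {x\<in>C. f n x < 1})"
    by fastforce
  then show ?thesis
    by (rule finite_subset) (simp add: assms(3))
qed

lemma antimono_positive_minorant:
  fixes W :: "'a \<Rightarrow> 'b::linorder" and f :: "'a \<Rightarrow> real"
  assumes fin: "\<And>r. finite {s\<in>C. W s \<le> r}" and "\<And>s. s \<in> C \<Longrightarrow> 0 < f s"
  obtains d :: "'b \<Rightarrow> real" where
    "antimono d" "\<And>r. 0 < d r" "\<And>r. d r \<le> 1" "\<And>s. s \<in> C \<Longrightarrow> d (W s) \<le> f s"
proof
  define d where "d r = Min (insert 1 (f ` {s\<in>C. W s \<le> r}))" for r
  show "antimono d"
    unfolding d_def antimono_def
    by (intro allI impI Min_antimono insert_mono image_mono) (auto simp: fin)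
  show "0 < d r" "d r \<le> 1" for r
    using assms by (auto simp: d_def)
  show "d (W s) \<le> f s" if "s \<in> C" for s
    unfolding d_def using that by (intro Min_le) (auto simp: fin)
qed

subsection \<open>Path events\<close>

abbreviation path_space :: "(nat \<Rightarrow> 's) measure" where
  "path_space \<equiv> PiM UNIV (\<lambda>_. count_space UNIV)"

abbreviation cylinder :: "nat \<Rightarrow> (nat \<Rightarrow> 's) \<Rightarrow> (nat \<Rightarrow> 's) set" where
  "cylinder n t \<equiv> {\<omega>. \<forall>i\<le>n. \<omega> i = t i}"

lemma path_event_in_sets: "Measurable.pred path_space Q \<Longrightarrow> {\<omega>. Q \<omega>} \<in> sets path_space"
  by (simp add: pred_def space_PiM)

lemma Compl_path_event_in_sets: "E \<in> sets path_space \<Longrightarrow> - E \<in> sets path_space"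
  using sets.compl_sets[of E path_space] by (simp add: space_PiM Compl_eq_Diff_UNIV)

lemma cylinder_in_sets: "cylinder n t \<in> sets path_space"
  by (rule path_event_in_sets) measurable

lemma case_nat_measurable [measurable]: "case_nat s \<in> measurable path_space path_space"
  by (rule measurable_PiM_single') (auto simp: space_PiM split: nat.split)

lemma vimage_case_nat_in_sets:
  "E \<in> sets path_space \<Longrightarrow> case_nat s -` E \<in> sets path_space"
  using measurable_sets[OF case_nat_measurable] by (auto simp: space_PiM)

lemma vimage_case_nat_cylinder_0: "case_nat s -` cylinder 0 t = (if s = t 0 then UNIV else {})"
  by auto

lemma vimage_case_nat_cylinder_Suc:
  "case_nat s -` cylinder (Suc n) t = (if s = t 0 then cylinder n (\<lambda>i. t (Suc i)) else {})"
  by (auto simp: less_Suc_eq_le[symmetric] All_less_Suc2)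

definition stay :: "'s set \<Rightarrow> (nat \<Rightarrow> 's) set" where
  "stay C = {\<omega>. \<forall>n. \<omega> n \<in> C}"

definition stay_upto :: "nat \<Rightarrow> 's set \<Rightarrow> (nat \<Rightarrow> 's) set" where
  "stay_upto n C = {\<omega>. \<forall>i<n. \<omega> i \<in> C}"

definition reach_within :: "'s set \<Rightarrow> 's set \<Rightarrow> (nat \<Rightarrow> 's) set" where
  "reach_within C X = {\<omega>. \<exists>n. \<omega> n \<in> X \<and> (\<forall>i\<le>n. \<omega> i \<in> C)}"

lemma stay_in_sets: "stay (C :: 's::countable set) \<in> sets path_space"
  unfolding stay_def by (rule path_event_in_sets) measurable

lemma stay_upto_in_sets: "stay_upto n (C :: 's::countable set) \<in> sets path_space"
  unfolding stay_upto_def by (rule path_event_in_sets) measurable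

lemma reach_within_in_sets: "reach_within C (X :: 's::countable set) \<in> sets path_space"
  unfolding reach_within_def by (rule path_event_in_sets) measurable

lemma All_nat_iff: "(\<forall>n. Q n) \<longleftrightarrow> Q 0 \<and> (\<forall>n. Q (Suc n))"
  by (metis not0_implies_Suc)

lemma Ex_nat_iff: "(\<exists>n. Q n) \<longleftrightarrow> Q 0 \<or> (\<exists>n. Q (Suc n))"
  by (metis not0_implies_Suc)

lemma vimage_case_nat_stay: "case_nat s -` stay C = (if s \<in> C then stay C else {})"
  by (auto simp: stay_def All_nat_iff[of "\<lambda>n. case_nat _ _ n \<in> _"])

lemma vimage_case_nat_stay_upto_Suc:
  "case_nat s -` stay_upto (Suc n) C = (if s \<in> C then stay_upto n C else {})"
  by (auto simp: stay_upto_def All_less_Suc2)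

lemma vimage_case_nat_reach_within:
  "case_nat s -` reach_within C X =
    (if s \<notin> C then {} else if s \<in> X then UNIV else reach_within C X)"
proof -
  have "case_nat s \<omega> \<in> reach_within C X \<longleftrightarrow> s \<in> C \<and> (s \<in> X \<or> \<omega> \<in> reach_within C X)" for \<omega>
    unfolding reach_within_def mem_Collect_eq
    by (subst Ex_nat_iff) (auto simp: less_Suc_eq_le[symmetric] All_less_Suc2)
  then show ?thesis by auto
qed

lemma Fin_eq_eventually: "Fin X = {\<omega>. \<forall>\<^sub>F m in sequentially. \<omega> m \<notin> X}"
  by (auto simp: Fin_def eventually_sequentially)

lemma Inf_often_eq_Compl_Fin: "Inf_often X = - Fin X"
  by (auto simp: Inf_often_def Fin_def)

lemma Fin_in_sets: "Fin (X :: 's::countable set) \<in> sets path_space"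
  unfolding Fin_eq_eventually eventually_sequentially by (rule path_event_in_sets) measurable

lemma Inf_often_in_sets: "Inf_often (X :: 's::countable set) \<in> sets path_space"
  unfolding Inf_often_eq_Compl_Fin by (intro Compl_path_event_in_sets Fin_in_sets)

lemma vimage_case_nat_Fin: "case_nat s -` Fin X = Fin X"
proof -
  have "case_nat s \<omega> \<in> Fin X \<longleftrightarrow> \<omega> \<in> Fin X" for \<omega>
    using eventually_sequentially_Suc[of "\<lambda>m. case_nat s \<omega> m \<notin> X"]
    by (simp add: Fin_eq_eventually)
  then show ?thesis by auto
qed

lemma vimage_case_nat_Inf_often: "case_nat s -` Inf_often X = Inf_often X"
  by (simp only: Inf_often_eq_Compl_Fin vimage_Compl vimage_case_nat_Fin)

lemma Streett_in_sets:
  fixes A B :: "'i \<Rightarrow> 's::countable set"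
  assumes "countable K"
  shows "(\<Inter>i\<in>K. Fin (A i) \<union> Inf_often (B i)) \<in> sets path_space"
proof -
  have "(\<Union>i\<in>K. - (Fin (A i) \<union> Inf_often (B i))) \<in> sets path_space"
    using assms
    by (intro sets.countable_UN' image_subsetI Compl_path_event_in_sets sets.Un
        Fin_in_sets Inf_often_in_sets)
  then have "- (\<Union>i\<in>K. - (Fin (A i) \<union> Inf_often (B i))) \<in> sets path_space"
    by (rule Compl_path_event_in_sets)
  then show ?thesis
    by (simp only: Compl_UN double_complement)
qed

lemma vimage_case_nat_Streett:
  "case_nat s -` (\<Inter>i\<in>K. Fin (A i) \<union> Inf_often (B i)) = (\<Inter>i\<in>K. Fin (A i) \<union> Inf_often (B i))"
  by (simp only: vimage_INT vimage_Un vimage_case_nat_Fin vimage_case_nat_Inf_often)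

subsection \<open>The Markov property\<close>

lemma emeasure_prod_emb_eq_nn_integral_cylinder:
  fixes X :: "nat \<Rightarrow> 's::countable set"
  assumes "sets M = sets path_space" "J \<subseteq> {..n}"
  shows "emeasure M (prod_emb UNIV (\<lambda>_. count_space UNIV) J (Pi\<^sub>E J X)) =
    (\<integral>\<^sup>+t. emeasure M (cylinder n t) \<partial>count_space {t \<in> {..n} \<rightarrow>\<^sub>E UNIV. \<forall>i\<in>J. t i \<in> X i})"
    (is "emeasure M ?Box = integral\<^sup>N (count_space ?R) _")
proof -
  have "?Box = (\<Union>t\<in>?R. cylinder n t)"
  proof (intro set_eqI iffI)
    fix \<omega> assume "\<omega> \<in> ?Box"
    then have "restrict \<omega> {..n} \<in> ?R"
      using assms(2) by (auto simp: prod_emb_iff)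
    then show "\<omega> \<in> (\<Union>t\<in>?R. cylinder n t)"
      by (rule UN_I) simp
  next
    fix \<omega> assume "\<omega> \<in> (\<Union>t\<in>?R. cylinder n t)"
    then show "\<omega> \<in> ?Box"
      using assms(2) by (auto simp: prod_emb_iff)
  qed
  moreover have "disjoint_family_on (cylinder n) ?R"
  proof (unfold disjoint_family_on_def, intro ballI impI)
    fix t u assume "t \<in> ?R" "u \<in> ?R" "t \<noteq> u"
    then obtain i where "i \<le> n" "t i \<noteq> u i"
      by (metis (mono_tags, lifting) PiE_ext atMost_iff mem_Collect_eq)
    then show "cylinder n t \<inter> cylinder n u = {}"
      by auto
  qed
  moreover have "countable ?R"
    by (rule countable_subset[of _ "{..n} \<rightarrow>\<^sub>E UNIV"]) (auto intro: countable_PiE)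
  ultimately show ?thesis
    by (simp add: emeasure_UN_countable cylinder_in_sets assms(1))
qed

lemma measure_eqI_cylinder:
  fixes M N :: "(nat \<Rightarrow> 's::countable) measure"
  assumes "sets M = sets path_space" "sets N = sets path_space" "finite_measure M"
    and "\<And>n t. emeasure M (cylinder n t) = emeasure N (cylinder n t)"
  shows "M = N"
proof (rule measure_eqI_PiM_infinite[OF assms(1,2) _ assms(3)])
  fix X :: "nat \<Rightarrow> 's set" and J :: "nat set"
  assume "finite J"
  then obtain n where "J \<subseteq> {..n}"
    using finite_nat_set_iff_bounded_le[of J] by blast
  then show "emeasure M (prod_emb UNIV (\<lambda>_. count_space UNIV) J (Pi\<^sub>E J X)) =
      emeasure N (prod_emb UNIV (\<lambda>_. count_space UNIV) J (Pi\<^sub>E J X))"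
    using assms by (simp add: emeasure_prod_emb_eq_nn_integral_cylinder)
qed

lemma prob_space_chain_law: "prob_space (chain_law \<mu> P)"
proof -
  interpret IT: Ionescu_Tulcea "chain_step \<mu> P" "\<lambda>_. count_space UNIV"
    by (rule Ionescu_Tulcea_chain_step)
  have "(\<lambda>\<omega>. restrict \<omega> {}) \<in> measurable IT.PF.lim (PiM {} (\<lambda>_. count_space UNIV))"
    by (simp add: measurable_cong_sets[OF IT.PF.sets_lim refl] measurable_restrict)
  then show ?thesis
    unfolding chain_law_def
    by (rule prob_space_distrD) (simp add: IT.distr_lim IT.PF.prob_space_P)
qed

context
  fixes P :: "'s::countable \<Rightarrow> 's pmf"
begin

abbreviation chain_from :: "'s \<Rightarrow> (nat \<Rightarrow> 's) measure" where
  "chain_from s \<equiv> chain_law (return_pmf s) P"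

abbreviation prob_from :: "'s \<Rightarrow> (nat \<Rightarrow> 's) set \<Rightarrow> real" where
  "prob_from s E \<equiv> measure (chain_from s) E"

interpretation law: prob_space "chain_law \<mu> P" for \<mu>
  by (rule prob_space_chain_law)

lemma measure_chain_law_Compl:
  "E \<in> sets path_space \<Longrightarrow> measure (chain_law \<mu> P) (- E) = 1 - measure (chain_law \<mu> P) E"
  using law.prob_compl[of E \<mu>] by (simp add: sets_chain_law Compl_eq_Diff_UNIV)

lemma emeasure_bind_chain_from:
  assumes "E \<in> sets path_space"
  shows "emeasure (measure_pmf \<mu> \<bind> chain_from) E = (\<integral>\<^sup>+s. emeasure (chain_from s) E \<partial>\<mu>)"
  using assms
  by (intro emeasure_bind[where N = path_space])
     (auto simp: space_subprob_algebra sets_chain_law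
        intro: prob_space_imp_subprob_space prob_space_chain_law)

lemma chain_law_eq_bind: "chain_law \<mu> P = measure_pmf \<mu> \<bind> chain_from"
proof (rule measure_eqI_cylinder)
  fix n and t :: "nat \<Rightarrow> 's"
  have "emeasure (measure_pmf \<mu> \<bind> chain_from) (cylinder n t) =
      (\<integral>\<^sup>+s. emeasure (chain_from s) (cylinder n t) \<partial>\<mu>)"
    by (rule emeasure_bind_chain_from[OF cylinder_in_sets])
  also have "\<dots> = (\<integral>\<^sup>+s. ennreal (\<Prod>i<n. pmf (P (t i)) (t (Suc i))) * indicator {t 0} s \<partial>\<mu>)"
    by (auto simp: emeasure_chain_law_cylinder indicator_def intro!: nn_integral_cong)
  also have "\<dots> = emeasure (chain_law \<mu> P) (cylinder n t)"
    by (subst nn_integral_cmult_indicator)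
       (simp_all add: emeasure_pmf_single emeasure_chain_law_cylinder ennreal_mult' mult.commute)
  finally show "emeasure (chain_law \<mu> P) (cylinder n t) =
      emeasure (measure_pmf \<mu> \<bind> chain_from) (cylinder n t)" ..
next
  show "sets (measure_pmf \<mu> \<bind> chain_from) = sets path_space"
    by (rule sets_bind) (auto simp: sets_chain_law)
qed (simp_all add: sets_chain_law law.finite_measure_axioms)

lemma wsum_prob_from:
  assumes "E \<in> sets path_space"
  shows "wsum \<mu> (\<lambda>s. prob_from s E) = ennreal (measure (chain_law \<mu> P) E)"
  using emeasure_bind_chain_from[OF assms, of \<mu>]
  unfolding chain_law_eq_bind[symmetric]
  by (simp add: law.emeasure_eq_measure wsum_eq_nn_integral)

lemma chain_from_eq_distr: "chain_from s = distr (chain_law (P s) P) path_space (case_nat s)"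
proof (rule measure_eqI_cylinder)
  fix n and t :: "nat \<Rightarrow> 's"
  have "emeasure (distr (chain_law (P s) P) path_space (case_nat s)) (cylinder n t) =
      emeasure (chain_law (P s) P) (case_nat s -` cylinder n t)"
    by (subst emeasure_distr) (simp_all add: cylinder_in_sets)
  also have "\<dots> = emeasure (chain_from s) (cylinder n t)"
  proof (cases n)
    case 0
    show ?thesis
      unfolding \<open>n = 0\<close> vimage_case_nat_cylinder_0 emeasure_chain_law_cylinder
      using law.emeasure_space_1[of "P s"] by auto
  next
    case (Suc m)
    show ?thesis
      unfolding \<open>n = Suc m\<close> vimage_case_nat_cylinder_Suc
      by (simp add: emeasure_chain_law_cylinder prod.lessThan_Suc_shift del: prod.lessThan_Suc)
  qed
  finally show "emeasure (chain_from s) (cylinder n t) =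
      emeasure (distr (chain_law (P s) P) path_space (case_nat s)) (cylinder n t)" ..
qed (simp_all add: sets_chain_law law.finite_measure_axioms)

lemma prob_from_first_step:
  assumes "E \<in> sets path_space"
  shows "ennreal (prob_from s E) = wsum (P s) (\<lambda>u. prob_from u (case_nat s -` E))"
proof -
  have "prob_from s E = measure (chain_law (P s) P) (case_nat s -` E)"
    using assms by (subst chain_from_eq_distr, subst measure_distr) simp_all
  then show ?thesis
    using assms by (simp add: wsum_prob_from vimage_case_nat_in_sets)
qed

lemma wsum_prob_from_shift_invariant:
  "E \<in> sets path_space \<Longrightarrow> (\<And>s. case_nat s -` E = E) \<Longrightarrow>
    wsum (P s) (\<lambda>u. prob_from u E) = ennreal (prob_from s E)"
  by (simp add: prob_from_first_step)

lemma prob_from_eq_0_of_vimage_empty: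
  "E \<in> sets path_space \<Longrightarrow> case_nat s -` E = {} \<Longrightarrow> prob_from s E = 0"
  using prob_from_first_step[of E s] by (simp add: wsum_eq_nn_integral)

subsection \<open>Staying in a set and reaching a set\<close>

lemma prob_from_stay_notin: "s \<notin> C \<Longrightarrow> prob_from s (stay C) = 0"
  by (simp add: prob_from_eq_0_of_vimage_empty stay_in_sets vimage_case_nat_stay)

lemma wsum_prob_from_stay:
  "s \<in> C \<Longrightarrow> wsum (P s) (\<lambda>u. prob_from u (stay C)) = ennreal (prob_from s (stay C))"
  by (simp add: prob_from_first_step[of "stay C" s] stay_in_sets vimage_case_nat_stay)

lemma prob_from_stay_upto_Suc_notin: "s \<notin> C \<Longrightarrow> prob_from s (stay_upto (Suc n) C) = 0"
  by (simp add: prob_from_eq_0_of_vimage_empty stay_upto_in_sets vimage_case_nat_stay_upto_Suc)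

lemma wsum_prob_from_stay_upto:
  "s \<in> C \<Longrightarrow>
    wsum (P s) (\<lambda>u. prob_from u (stay_upto n C)) = ennreal (prob_from s (stay_upto (Suc n) C))"
  by (simp add: prob_from_first_step[of "stay_upto (Suc n) C" s] stay_upto_in_sets
      vimage_case_nat_stay_upto_Suc)

lemma prob_from_stay_upto_0: "prob_from s (stay_upto 0 C) = 1"
  using law.prob_space by (simp add: stay_upto_def)

lemma prob_from_stay_upto_1: "s \<in> C \<Longrightarrow> prob_from s (stay_upto (Suc 0) C) = 1"
  using wsum_prob_from_stay_upto[of s C 0]
  by (simp add: prob_from_stay_upto_0 wsum_eq_nn_integral)

lemma prob_from_stay_upto_tendsto:
  "(\<lambda>n. prob_from s (stay_upto n C)) \<longlonglongrightarrow> prob_from s (stay C)"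
proof -
  have "(\<Inter>n. stay_upto n C) = stay C"
    by (auto simp: stay_def stay_upto_def)
  moreover have "decseq (\<lambda>n. stay_upto n C)"
    by (auto simp: decseq_def stay_upto_def)
  ultimately show ?thesis
    using law.finite_Lim_measure_decseq[of "\<lambda>n. stay_upto n C" "return_pmf s"]
    by (simp add: image_subset_iff sets_chain_law stay_upto_in_sets)
qed

lemma prob_from_reach_within_notin: "s \<notin> C \<Longrightarrow> prob_from s (reach_within C X) = 0"
  by (simp add: prob_from_eq_0_of_vimage_empty reach_within_in_sets vimage_case_nat_reach_within)

lemma prob_from_reach_within_eq_1:
  assumes "s \<in> C" "s \<in> X"
  shows "prob_from s (reach_within C X) = 1"
proof -
  have "ennreal (prob_from s (reach_within C X)) = wsum (P s) (\<lambda>u. prob_from u UNIV)"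
    using assms
    by (simp add: prob_from_first_step[OF reach_within_in_sets] vimage_case_nat_reach_within)
  also have "\<dots> = 1"
    using law.prob_space by (simp add: wsum_eq_nn_integral)
  finally show ?thesis by simp
qed

lemma wsum_prob_from_reach_within_le:
  assumes "s \<in> C"
  shows "wsum (P s) (\<lambda>u. prob_from u (reach_within C X)) \<le> ennreal (prob_from s (reach_within C X))"
proof -
  have "reach_within C X \<subseteq> case_nat s -` reach_within C X"
    using assms by (auto simp: vimage_case_nat_reach_within)
  then show ?thesis
    unfolding prob_from_first_step[OF reach_within_in_sets, of s]
    by (intro wsum_mono law.finite_measure_mono)
       (simp_all add: sets_chain_law reach_within_in_sets vimage_case_nat_in_sets)
qed

text \<open>
  If \<open>c\<close> bounds \<open>v = prob_from _ (stay C)\<close>, then restarting the chain at time \<open>n\<close> gives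
  \<open>v \<le> c * prob_from _ (stay_upto n C)\<close>, hence \<open>v \<le> c * v\<close> in the limit.
  This replaces Levy's zero-one law.
\<close>

lemma ex_prob_from_stay_gt:
  assumes "0 < prob_from s (stay C)" "c < 1"
  shows "\<exists>u. c < prob_from u (stay C)"
proof (rule ccontr)
  assume "\<not> ?thesis"
  then have bound: "prob_from u (stay C) \<le> c" for u
    by (simp add: not_less)
  then have "0 \<le> c"
    using measure_nonneg order_trans by blast
  have "prob_from u (stay C) \<le> c * prob_from u (stay_upto n C)" for u n
  proof (induction n arbitrary: u)
    case 0
    show ?case
      using bound by (simp add: prob_from_stay_upto_0)
  next
    case (Suc n)
    show ?case
    proof (cases "u \<in> C")
      case True
      then have "ennreal (prob_from u (stay C)) = wsum (P u) (\<lambda>v. prob_from v (stay C))"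
        by (simp add: wsum_prob_from_stay)
      also have "\<dots> \<le> wsum (P u) (\<lambda>v. c * prob_from v (stay_upto n C))"
        using Suc.IH by (intro wsum_mono) simp_all
      also have "\<dots> = ennreal (c * prob_from u (stay_upto (Suc n) C))"
        using True \<open>0 \<le> c\<close> by (simp add: wsum_cmult wsum_prob_from_stay_upto ennreal_mult)
      finally show ?thesis
        using \<open>0 \<le> c\<close> by simp
    qed (simp add: prob_from_stay_notin \<open>0 \<le> c\<close>)
  qed
  then have "prob_from s (stay C) \<le> c * prob_from s (stay C)"
    by (intro tendsto_lowerbound[OF tendsto_mult_left[OF prob_from_stay_upto_tendsto]]) auto
  then show False
    using assms by (simp add: mult_le_cancel_right2)
qed

lemma prob_from_stay_eq_0_of_null_Int:
  assumes "0 < \<gamma>" "E \<in> sets path_space"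
    and likely: "\<And>u. u \<in> C \<Longrightarrow> \<gamma> \<le> prob_from u E"
    and null: "\<And>u. u \<in> C \<Longrightarrow> prob_from u (E \<inter> stay C) = 0"
  shows "prob_from s (stay C) = 0"
proof (rule ccontr)
  assume "prob_from s (stay C) \<noteq> 0"
  then obtain u where u: "max 0 (1 - \<gamma>) < prob_from u (stay C)"
    using ex_prob_from_stay_gt[of s C "max 0 (1 - \<gamma>)"] \<open>0 < \<gamma>\<close>
    by (auto simp: zero_less_measure_iff)
  then have "u \<in> C"
    using prob_from_stay_notin[of u C] by fastforce
  have "prob_from u (E \<union> stay C) = prob_from u E + prob_from u (stay C)"
    using null[OF \<open>u \<in> C\<close>] \<open>E \<in> sets path_space\<close>
    by (simp add: measure_Un3 law.fmeasurable_eq_sets sets_chain_law stay_in_sets)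
  then show False
    using u likely[OF \<open>u \<in> C\<close>] law.prob_le_1[of "return_pmf u" "E \<union> stay C"] by simp
qed

lemma prob_from_stay_Diff_eq_0:
  assumes "0 < \<gamma>" "\<And>u. u \<in> C \<Longrightarrow> \<gamma> \<le> prob_from u (reach_within UNIV X)"
  shows "prob_from s (stay (C - X)) = 0"
proof (rule prob_from_stay_eq_0_of_null_Int[OF \<open>0 < \<gamma>\<close> reach_within_in_sets])
  have "reach_within UNIV X \<inter> stay (C - X) = {}"
    by (auto simp: reach_within_def stay_def)
  then show "prob_from u (reach_within UNIV X \<inter> stay (C - X)) = 0" for u
    by simp
qed (use assms in auto)

lemma prob_from_Fin_eq_0:
  assumes "\<And>u. prob_from u (stay (- X)) = 0"
  shows "prob_from s (Fin X) = 0"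
proof -
  define tail where "tail n = {\<omega>::nat \<Rightarrow> 's. \<forall>m\<ge>n. \<omega> m \<notin> X}" for n
  have tail_in_sets: "tail n \<in> sets path_space" for n
    unfolding tail_def by (rule path_event_in_sets) measurable
  have "prob_from u (tail n) = 0" for u n
  proof (induction n arbitrary: u)
    case 0
    show ?case
      using assms by (simp add: tail_def stay_def)
  next
    case (Suc n)
    have "case_nat u -` tail (Suc n) = tail n"
      by (auto simp: tail_def split: nat.splits)
    then have "ennreal (prob_from u (tail (Suc n))) = 0"
      by (simp add: prob_from_first_step tail_in_sets Suc.IH wsum_eq_nn_integral)
    then show ?case by simp
  qed
  then have "emeasure (chain_from s) (\<Union>n. tail n) = 0"
    by (intro emeasure_UN_eq_0)
       (auto simp: law.emeasure_eq_measure sets_chain_law tail_in_sets)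
  moreover have "Fin X = (\<Union>n. tail n)"
    by (auto simp: tail_def Fin_def)
  ultimately show ?thesis
    by (simp add: law.emeasure_eq_measure)
qed

lemma prob_from_stay_eq_0_of_Streett_pair:
  assumes "C \<inter> B = {}"
    and "0 < \<gamma>" "\<And>u. u \<in> C \<Longrightarrow> \<gamma> \<le> prob_from u (reach_within UNIV A)"
    and "0 < \<delta>" "\<And>u. u \<in> C \<Longrightarrow> \<delta> \<le> prob_from u (Fin A \<union> Inf_often B)"
  shows "prob_from s (stay C) = 0"
proof (rule prob_from_stay_eq_0_of_null_Int[OF \<open>0 < \<delta>\<close>])
  fix u
  have "Fin A \<inter> stay C \<subseteq> Fin (- (C - A))" "Inf_often B \<inter> stay C = {}"
    using \<open>C \<inter> B = {}\<close> by (auto simp: Fin_def Inf_often_def stay_def)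
  then have "prob_from u ((Fin A \<union> Inf_often B) \<inter> stay C) \<le> prob_from u (Fin (- (C - A)))"
    by (intro law.finite_measure_mono) (auto simp: sets_chain_law Fin_in_sets)
  also have "\<dots> = 0"
    using prob_from_stay_Diff_eq_0[OF assms(2,3)]
    by (intro prob_from_Fin_eq_0) (simp only: double_complement)
  finally show "prob_from u ((Fin A \<union> Inf_often B) \<inter> stay C) = 0"
    by (simp add: measure_le_0_iff)
qed (use assms(5) in \<open>auto intro: Fin_in_sets Inf_often_in_sets\<close>)

lemma prob_from_reach_within_tendsto_0:
  assumes "prob_from s (stay C) = 0" "decseq X" "(\<Inter>n. X n) = {}"
  shows "(\<lambda>n. prob_from s (reach_within C (X n))) \<longlonglongrightarrow> 0"
proof -
  have "(\<Inter>n. reach_within C (X n)) \<subseteq> stay C"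
  proof (rule subsetI, rule ccontr)
    fix \<omega> assume reach: "\<omega> \<in> (\<Inter>n. reach_within C (X n))" and "\<omega> \<notin> stay C"
    then obtain k where "\<omega> k \<notin> C"
      by (auto simp: stay_def)
    have "\<forall>\<^sub>F n in sequentially. \<omega> m \<notin> X n" for m
    proof -
      obtain n where "\<omega> m \<notin> X n"
        using \<open>(\<Inter>n. X n) = {}\<close> by blast
      then have "\<forall>n'\<ge>n. \<omega> m \<notin> X n'"
        using decseqD[OF \<open>decseq X\<close>] by blast
      then show ?thesis
        by (auto simp: eventually_sequentially)
    qed
    then have "\<forall>\<^sub>F n in sequentially. \<forall>m\<in>{..<k}. \<omega> m \<notin> X n"
      by (simp add: eventually_ball_finite)
    then obtain n where n: "\<And>m. m < k \<Longrightarrow> \<omega> m \<notin> X n"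
      by (auto simp: eventually_sequentially)
    obtain m where "\<omega> m \<in> X n" "\<forall>i\<le>m. \<omega> i \<in> C"
      using reach by (auto simp: reach_within_def)
    with n \<open>\<omega> k \<notin> C\<close> show False
      by (meson not_le)
  qed
  then have "prob_from s (\<Inter>n. reach_within C (X n)) = 0"
    using assms(1) law.finite_measure_mono[of _ "stay C" "return_pmf s"]
    by (fastforce simp: sets_chain_law stay_in_sets measure_le_0_iff)
  moreover have "decseq (\<lambda>n. reach_within C (X n))"
    using \<open>decseq X\<close> unfolding decseq_def reach_within_def by blast
  ultimately show ?thesis
    using law.finite_Lim_measure_decseq[of "\<lambda>n. reach_within C (X n)" "return_pmf s"]
    by (simp add: image_subset_iff sets_chain_law reach_within_in_sets)
qed

subsection \<open>Lyapunov functions\<close>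

definition discounted_survival :: "'s set \<Rightarrow> 's \<Rightarrow> real" where
  "discounted_survival C s = (\<Sum>n. (1/2)^n * prob_from s (stay_upto (Suc n) C))"

lemma summable_discounted_survival:
  "summable (\<lambda>n. (1/2)^n * prob_from s (stay_upto (n + k) C))"
  by (rule summable_comparison_test'[where g = "\<lambda>n. (1/2)^n" and N = 0])
     (auto intro!: summable_geometric mult_left_le)

lemma discounted_survival_nonneg: "0 \<le> discounted_survival C s"
  unfolding discounted_survival_def
  using summable_discounted_survival[of s 1 C] by (intro suminf_nonneg) auto

lemma discounted_survival_notin: "s \<notin> C \<Longrightarrow> discounted_survival C s = 0"
  by (simp add: discounted_survival_def prob_from_stay_upto_Suc_notin)

lemma discounted_survival_less_2:
  assumes "prob_from s (stay C) < 1"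
  shows "discounted_survival C s < 2"
proof -
  let ?p = "\<lambda>n. prob_from s (stay_upto (Suc n) C)"
  have "?p \<longlonglongrightarrow> prob_from s (stay C)"
    using prob_from_stay_upto_tendsto by (rule LIMSEQ_Suc)
  then have "\<forall>\<^sub>F n in sequentially. ?p n < 1"
    using assms by (rule order_tendstoD)
  then obtain n where "?p n < 1"
    using eventually_happens'[OF sequentially_bot] by blast
  have summable: "summable (\<lambda>n. (1/2)^n - (1/2)^n * ?p n)"
    using summable_discounted_survival[of s 1 C] by (intro summable_diff summable_geometric) auto
  have "0 < (\<Sum>n. (1/2)^n - (1/2)^n * ?p n)"
    using summable \<open>?p n < 1\<close> by (intro suminf_pos2[where i = n]) (auto intro: mult_left_le)
  also have "\<dots> = 2 - discounted_survival C s"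
    using summable_discounted_survival[of s 1 C]
    by (simp add: discounted_survival_def suminf_diff[symmetric] summable_geometric suminf_geometric)
  finally show ?thesis by simp
qed

lemma wsum_discounted_survival:
  assumes "s \<in> C"
  shows "wsum (P s) (discounted_survival C) = ennreal (2 * discounted_survival C s - 2)"
proof -
  let ?p = "\<lambda>n u. prob_from u (stay_upto n C)"
  have "wsum (P s) (discounted_survival C) = (\<Sum>n. wsum (P s) (\<lambda>u. (1/2)^n * ?p (Suc n) u))"
    unfolding discounted_survival_def
    using summable_discounted_survival[of _ 1 C] by (intro wsum_suminf) auto
  also have "\<dots> = (\<Sum>n. ennreal ((1/2)^n * ?p (Suc (Suc n)) s))"
    using assms by (simp add: wsum_cmult wsum_prob_from_stay_upto ennreal_mult)
  also have "\<dots> = ennreal (\<Sum>n. (1/2)^n * ?p (Suc (Suc n)) s)"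
    using summable_discounted_survival[of s 2 C] by (intro suminf_ennreal2) auto
  also have "(\<Sum>n. (1/2)^n * ?p (Suc (Suc n)) s) =
      2 * (\<Sum>n. (1/2)^Suc n * ?p (Suc (Suc n)) s)"
    using summable_discounted_survival[of s 2 C] by (simp add: suminf_mult[symmetric])
  also have "\<dots> = 2 * discounted_survival C s - 2"
    using suminf_split_head[OF summable_discounted_survival[of s 1 C]]
    by (simp add: discounted_survival_def prob_from_stay_upto_1[OF assms])
  finally show ?thesis .
qed

lemma wsum_discounted_survival_less:
  assumes "s \<in> C" "prob_from s (stay C) < 1"
  shows "wsum (P s) (discounted_survival C) < ennreal (discounted_survival C s)"
proof -
  have "0 < discounted_survival C s"
    unfolding discounted_survival_def
    using assms(1) summable_discounted_survival[of s 1 C]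
    by (intro suminf_pos2[where i = 0]) (auto simp: prob_from_stay_upto_1)
  moreover have "2 * discounted_survival C s - 2 < discounted_survival C s"
    using discounted_survival_less_2[OF assms(2)] by simp
  ultimately show ?thesis
    unfolding wsum_discounted_survival[OF assms(1)] by (rule ennreal_lessI)
qed

lemma proper_supermartingale_exists:
  assumes "\<And>s. prob_from s (stay C) = 0"
  obtains F :: "'s \<Rightarrow> real" where
    "\<And>s. 0 \<le> F s" "\<And>s. s \<notin> C \<Longrightarrow> F s = 0"
    "\<And>s. s \<in> C \<Longrightarrow> wsum (P s) F \<le> ennreal (F s)" "\<And>r. finite {s\<in>C. F s \<le> r}"
proof -
  define w where "w n s = prob_from s (reach_within C {u. n \<le> to_nat u})" for n s
  have "(\<lambda>n. w n s) \<longlonglongrightarrow> 0" for s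
    unfolding w_def
  proof (rule prob_from_reach_within_tendsto_0[OF assms])
    show "decseq (\<lambda>n. {u::'s. n \<le> to_nat u})"
      by (auto simp: decseq_def)
    show "(\<Inter>n. {u::'s. n \<le> to_nat u}) = {}"
      using Suc_n_not_le_n by blast
  qed
  then obtain N where summable: "\<And>s. summable (\<lambda>j. w (N j) s)"
    using summable_subsequence_of_tendsto_0[of w] by blast
  have w_nonneg: "0 \<le> w n s" for n s
    by (simp add: w_def)
  show thesis
  proof (rule that)
    show "0 \<le> (\<Sum>j. w (N j) s)" for s
      using summable w_nonneg by (rule suminf_nonneg)
    show "(\<Sum>j. w (N j) s) = 0" if "s \<notin> C" for s
      using that by (simp add: w_def prob_from_reach_within_notin)
    show "wsum (P s) (\<lambda>u. \<Sum>j. w (N j) u) \<le> ennreal (\<Sum>j. w (N j) s)" if "s \<in> C" for s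
      using w_nonneg summable wsum_prob_from_reach_within_le[OF that]
      by (intro wsum_suminf_le) (simp_all add: w_def)
    have "finite {s\<in>C. w n s < 1}" for n
    proof (rule finite_subset)
      show "{s\<in>C. w n s < 1} \<subseteq> to_nat -` {..<n}"
        by (force simp: w_def not_less dest: prob_from_reach_within_eq_1)
    qed (simp add: finite_vimageI inj_to_nat)
    with w_nonneg summable show "finite {s\<in>C. (\<Sum>j. w (N j) s) \<le> r}" for r
      by (rule finite_sublevel_suminf)
  qed
qed

lemma Lyapunov_function_exists:
  assumes "\<And>s. prob_from s (stay C) = 0"
  obtains W :: "'s \<Rightarrow> real" where
    "\<And>s. 0 \<le> W s" "\<And>s. s \<notin> C \<Longrightarrow> W s = 0"
    "\<And>s. s \<in> C \<Longrightarrow> wsum (P s) W < ennreal (W s)" "\<And>r. finite {s\<in>C. W s \<le> r}"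
proof -
  obtain F :: "'s \<Rightarrow> real" where F: "\<And>s. 0 \<le> F s" "\<And>s. s \<notin> C \<Longrightarrow> F s = 0"
      "\<And>s. s \<in> C \<Longrightarrow> wsum (P s) F \<le> ennreal (F s)" "\<And>r. finite {s\<in>C. F s \<le> r}"
    using proper_supermartingale_exists[OF assms] by blast
  let ?G = "discounted_survival C"
  show thesis
  proof (rule that)
    show "0 \<le> F s + ?G s" for s
      using F(1) discounted_survival_nonneg by simp
    show "F s + ?G s = 0" if "s \<notin> C" for s
      using that by (simp add: F(2) discounted_survival_notin)
    show "wsum (P s) (\<lambda>u. F u + ?G u) < ennreal (F s + ?G s)" if "s \<in> C" for s
    proof -
      have "wsum (P s) (\<lambda>u. F u + ?G u) = wsum (P s) F + wsum (P s) ?G"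
        using F(1) discounted_survival_nonneg by (rule wsum_add)
      also have "\<dots> \<le> ennreal (F s) + wsum (P s) ?G"
        using F(3)[OF that] by (rule add_right_mono)
      also have "\<dots> < ennreal (F s) + ennreal (?G s)"
        using that assms by (simp add: ennreal_add_left_cancel_less wsum_discounted_survival_less)
      also have "\<dots> = ennreal (F s + ?G s)"
        using F(1) discounted_survival_nonneg by (simp add: ennreal_plus)
      finally show ?thesis .
    qed
    show "finite {s\<in>C. F s + ?G s \<le> r}" for r
    proof (rule finite_subset[OF _ F(4)])
      show "{s\<in>C. F s + ?G s \<le> r} \<subseteq> {s\<in>C. F s \<le> r}"
        using discounted_survival_nonneg by (force intro: order_trans[rotated])
    qed
  qed
qed

lemma progress_functions_exist:
  assumes W: "\<And>s. 0 \<le> W s" "\<And>s. s \<in> C \<Longrightarrow> wsum (P s) W < ennreal (W s)"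
    "\<And>r. finite {s\<in>C. W s \<le> r}"
  obtains d q :: "real \<Rightarrow> real" where
    "antimono d" "antimono q" "\<And>r. 0 < d r" "\<And>r. 0 < q r" "\<And>r. q r \<le> 1"
    "\<And>s. s \<in> C \<Longrightarrow> q (W s) \<le> measure_pmf.prob (P s) {s'. W s' \<le> W s - d (W s)}"
proof -
  have "\<exists>x\<in>set_pmf (P s). W x < W s" if "s \<in> C" for s
    using W(1) W(2)[OF that] by (rule wsum_less_imp_ex_less)
  then obtain x where x: "\<And>s. s \<in> C \<Longrightarrow> x s \<in> set_pmf (P s)" "\<And>s. s \<in> C \<Longrightarrow> W (x s) < W s"
    by metis
  obtain d :: "real \<Rightarrow> real" where d: "antimono d" "\<And>r. 0 < d r" "\<And>r. d r \<le> 1"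
      "\<And>s. s \<in> C \<Longrightarrow> d (W s) \<le> W s - W (x s)"
    using antimono_positive_minorant[of C W "\<lambda>s. W s - W (x s)", OF W(3)] x(2) by auto
  obtain q :: "real \<Rightarrow> real" where q: "antimono q" "\<And>r. 0 < q r" "\<And>r. q r \<le> 1"
      "\<And>s. s \<in> C \<Longrightarrow> q (W s) \<le> pmf (P s) (x s)"
    using antimono_positive_minorant[of C W "\<lambda>s. pmf (P s) (x s)", OF W(3)] x(1)
    by (auto simp: pmf_positive)
  have "q (W s) \<le> measure_pmf.prob (P s) {s'. W s' \<le> W s - d (W s)}" if "s \<in> C" for s
  proof -
    have "q (W s) \<le> measure_pmf.prob (P s) {x s}"
      using q(4)[OF that] by (simp add: measure_pmf_single)
    also have "\<dots> \<le> measure_pmf.prob (P s) {s'. W s' \<le> W s - d (W s)}"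
      using d(4)[OF that] by (intro measure_pmf.finite_measure_mono) auto
    finally show ?thesis .
  qed
  from d(1) q(1) d(2) q(2,3) this show thesis
    by (rule that)
qed

subsection \<open>Streett certificates\<close>

definition Streett_certificate :: "'s set \<Rightarrow> 's set \<Rightarrow> 's set \<Rightarrow> 's set \<Rightarrow> ('s \<Rightarrow> real) \<Rightarrow>
    ('s \<Rightarrow> real) \<Rightarrow> (real \<Rightarrow> real) \<Rightarrow> (real \<Rightarrow> real) \<Rightarrow> bool" where
  "Streett_certificate I A B J V W d q \<longleftrightarrow>
    J \<subseteq> I - A \<and> (\<forall>s. 0 \<le> V s) \<and> (\<forall>s. 0 \<le> W s) \<and>
    (\<forall>r\<ge>0. 0 < d r) \<and> (\<forall>r\<ge>0. 0 < q r \<and> q r \<le> 1) \<and>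
    (\<forall>s. s \<notin> A \<longrightarrow> wsum (P s) V \<le> ennreal (V s)) \<and>
    (\<forall>s\<in>A. 1 \<le> V s) \<and>
    (\<exists>\<gamma>>0. \<forall>s\<in>J. V s \<le> 1 - \<gamma>) \<and>
    (\<forall>s\<in>I - (B \<union> J). 0 < W s \<and> wsum (P s) W \<le> ennreal (W s)) \<and>
    (\<forall>s\<in>I \<inter> (B \<union> J). W s = 0) \<and>
    (\<forall>r>0. \<forall>s\<in>I - (B \<union> J). W s = r \<longrightarrow>
      q r \<le> measure_pmf.prob (P s) {s'. W s' \<le> r - d r}) \<and>
    antimono_on {0<..} q \<and> antimono_on {0<..} d"

lemma Streett_certificate_exists:
  assumes "0 < \<delta>" "\<And>s. s \<in> I \<Longrightarrow> \<delta> \<le> prob_from s E" "E \<subseteq> Fin A \<union> Inf_often B"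
  shows "\<exists>J V W d q. Streett_certificate I A B J V W d q"
proof -
  define V where "V s = prob_from s (reach_within UNIV A)" for s
  define J where "J = {s\<in>I. V s \<le> 1/2}"
  let ?C = "I - (B \<union> J)"
  have V_A: "V s = 1" if "s \<in> A" for s
    using that by (simp add: V_def prob_from_reach_within_eq_1)
  have V_super: "wsum (P s) V \<le> ennreal (V s)" for s
    unfolding V_def by (rule wsum_prob_from_reach_within_le) simp
  have "\<delta> \<le> prob_from s (Fin A \<union> Inf_often B)" if "s \<in> I" for s
    using assms(2)[OF that] law.finite_measure_mono[OF assms(3), of "return_pmf s"]
    by (simp add: sets_chain_law Fin_in_sets Inf_often_in_sets sets.Un)
  then have "prob_from s (stay ?C) = 0" for s
    using \<open>0 < \<delta>\<close>
    by (intro prob_from_stay_eq_0_of_Streett_pair[where \<gamma> = "1/2" and \<delta> = \<delta> and A = A and B = B])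
       (auto simp: J_def V_def)
  then obtain W :: "'s \<Rightarrow> real" where W: "\<And>s. 0 \<le> W s" "\<And>s. s \<notin> ?C \<Longrightarrow> W s = 0"
      "\<And>s. s \<in> ?C \<Longrightarrow> wsum (P s) W < ennreal (W s)" "\<And>r. finite {s\<in>?C. W s \<le> r}"
    using Lyapunov_function_exists by blast
  obtain d q :: "real \<Rightarrow> real" where dq: "antimono d" "antimono q"
      "\<And>r. 0 < d r" "\<And>r. 0 < q r" "\<And>r. q r \<le> 1"
      "\<And>s. s \<in> ?C \<Longrightarrow> q (W s) \<le> measure_pmf.prob (P s) {s'. W s' \<le> W s - d (W s)}"
    using progress_functions_exist[OF W(1,3,4)] by blast
  have W_pos: "0 < W s" if "s \<in> ?C" for s
    using W(3)[OF that] W(1)[of s] by (cases "W s = 0") auto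
  have "J \<subseteq> I - A"
    using V_A by (auto simp: J_def)
  moreover have "\<exists>\<gamma>>0. \<forall>s\<in>J. V s \<le> 1 - \<gamma>"
    by (rule exI[of _ "1/2"]) (simp add: J_def)
  moreover have "antimono_on {0<..} q" "antimono_on {0<..} d"
    using dq(1,2) by (auto intro: monotone_on_subset)
  moreover have "0 \<le> V s" for s
    by (simp add: V_def)
  ultimately have "Streett_certificate I A B J V W d q"
    unfolding Streett_certificate_def
    using W(1,2) W(3)[THEN less_imp_le] W_pos dq(3-6) V_A V_super by auto
  then show ?thesis by blast
qed

lemma shift_invariant_event_supermartingale_exists:
  assumes E: "E \<in> sets path_space" "\<And>s. case_nat s -` E = E" and "0 < \<epsilon>"
  obtains \<delta> and V :: "'s \<Rightarrow> real" where "0 < \<delta>" "\<And>s. 0 \<le> V s"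
    "wsum \<mu> V \<le> ennreal (1 - measure (chain_law \<mu> P) E + \<epsilon>)"
    "\<And>s. wsum (P s) V \<le> ennreal (V s)" "\<And>s. prob_from s E < \<delta> \<Longrightarrow> 1 \<le> V s"
proof -
  define \<delta> where "\<delta> = \<epsilon> / (1 + \<epsilon>)"
  define V where "V s = (1 + \<epsilon>) * prob_from s (- E)" for s
  have wsum_V: "wsum D V = ennreal (1 + \<epsilon>) * wsum D (\<lambda>s. prob_from s (- E))" for D
    unfolding V_def using \<open>0 < \<epsilon>\<close> by (intro wsum_cmult) simp_all
  show thesis
  proof (rule that)
    show "0 < \<delta>"
      using \<open>0 < \<epsilon>\<close> by (simp add: \<delta>_def)
    show "0 \<le> V s" for s
      using \<open>0 < \<epsilon>\<close> by (simp add: V_def)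
    show "wsum \<mu> V \<le> ennreal (1 - measure (chain_law \<mu> P) E + \<epsilon>)"
    proof -
      have "wsum \<mu> V = ennreal (1 + \<epsilon>) * ennreal (measure (chain_law \<mu> P) (- E))"
        unfolding wsum_V by (simp only: wsum_prob_from Compl_path_event_in_sets E(1))
      also have "\<dots> = ennreal ((1 + \<epsilon>) * (1 - measure (chain_law \<mu> P) E))"
        using \<open>0 < \<epsilon>\<close> by (subst ennreal_mult[symmetric]) (simp_all add: measure_chain_law_Compl[OF E(1)])
      also have "(1 + \<epsilon>) * (1 - measure (chain_law \<mu> P) E) \<le> 1 - measure (chain_law \<mu> P) E + \<epsilon>"
        using \<open>0 < \<epsilon>\<close> by (simp add: algebra_simps)
      finally show ?thesis
        by (simp add: ennreal_leI)
    qed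
    show "wsum (P s) V \<le> ennreal (V s)" for s
      using \<open>0 < \<epsilon>\<close> E
      by (simp add: wsum_V V_def ennreal_mult wsum_prob_from_shift_invariant
          Compl_path_event_in_sets vimage_Compl)
    show "1 \<le> V s" if "prob_from s E < \<delta>" for s
      using that \<open>0 < \<epsilon>\<close> by (simp add: \<delta>_def V_def measure_chain_law_Compl[OF E(1)] field_simps)
  qed
qed

end

theorem theorem4p9:
  fixes \<mu> :: "'s::countable pmf" and P :: "'s \<Rightarrow> 's pmf"
    and k :: nat and A B :: "nat \<Rightarrow> 's set" and p :: real
  assumes "0 < p" and "p \<le> 1"
    and "measure (chain_law \<mu> P) (\<Inter>i\<in>{1..k}. Fin (A i) \<union> Inf_often (B i)) = p"
  shows "\<forall>\<epsilon>>0. \<exists>(I :: 's set) (V0 :: 's \<Rightarrow> real) (J :: nat \<Rightarrow> 's set)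
      (V :: nat \<Rightarrow> 's \<Rightarrow> real) (W :: nat \<Rightarrow> 's \<Rightarrow> real)
      (d :: nat \<Rightarrow> real \<Rightarrow> real) (q :: nat \<Rightarrow> real \<Rightarrow> real).
    (\<forall>s. 0 \<le> V0 s) \<and>
    wsum \<mu> V0 \<le> ennreal (1 - p + \<epsilon>) \<and>
    (\<forall>i\<in>{1..k}.
      J i \<subseteq> I - A i \<and>
      (\<forall>s. 0 \<le> V i s) \<and>
      (\<forall>s. 0 \<le> W i s) \<and>
      (\<forall>r\<ge>0. 0 < d i r) \<and>
      (\<forall>r\<ge>0. 0 < q i r \<and> q i r \<le> 1) \<and>
      (\<forall>s. s \<notin> A i \<longrightarrow> wsum (P s) (V i) \<le> ennreal (V i s)) \<and>
      (\<forall>s\<in>A i. 1 \<le> V i s) \<and>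
      (\<exists>\<gamma>>0. \<forall>s\<in>J i. V i s \<le> 1 - \<gamma>) \<and>
      (\<forall>s\<in>I - (B i \<union> J i). 0 < W i s \<and> wsum (P s) (W i) \<le> ennreal (W i s)) \<and>
      (\<forall>s\<in>I \<inter> (B i \<union> J i). W i s = 0) \<and>
      (\<forall>r>0. \<forall>s\<in>I - (B i \<union> J i). W i s = r \<longrightarrow>
        q i r \<le> measure_pmf.prob (P s) {s'. W i s' \<le> r - d i r}) \<and>
      antimono_on {0<..} (q i) \<and> antimono_on {0<..} (d i)) \<and>
    (\<forall>s\<in>I. wsum (P s) V0 \<le> ennreal (V0 s)) \<and>
    (\<forall>s. s \<notin> I \<longrightarrow> 1 \<le> V0 s)"
    (is "\<forall>\<epsilon>>0. ?Goal \<epsilon>")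
proof (intro allI impI)
  fix \<epsilon> :: real assume "\<epsilon> > 0"
  let ?Acc = "\<Inter>i\<in>{1..k}. Fin (A i) \<union> Inf_often (B i)"
  have "?Acc \<in> sets path_space"
    by (rule Streett_in_sets) simp
  then obtain \<delta> and V0 :: "'s \<Rightarrow> real" where "0 < \<delta>" and V0: "\<And>s. 0 \<le> V0 s"
      "wsum \<mu> V0 \<le> ennreal (1 - p + \<epsilon>)" "\<And>s. wsum (P s) V0 \<le> ennreal (V0 s)"
      "\<And>s. prob_from P s ?Acc < \<delta> \<Longrightarrow> 1 \<le> V0 s"
    using shift_invariant_event_supermartingale_exists[OF _ vimage_case_nat_Streett \<open>\<epsilon> > 0\<close>]
    unfolding assms(3)[symmetric] by blast
  define I where "I = {s. \<delta> \<le> prob_from P s ?Acc}"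
  have "\<exists>J V W d q. Streett_certificate P I (A i) (B i) J V W d q" if "i \<in> {1..k}" for i
    by (rule Streett_certificate_exists[OF \<open>0 < \<delta>\<close>, where E = ?Acc])
       (use that in \<open>auto simp: I_def\<close>)
  then obtain J V W d q where certificate:
    "\<forall>i\<in>{1..k}. Streett_certificate P I (A i) (B i) (J i) (V i) (W i) (d i) (q i)"
    by metis
  have "\<forall>s\<in>I. wsum (P s) V0 \<le> ennreal (V0 s)" "\<forall>s. s \<notin> I \<longrightarrow> 1 \<le> V0 s"
    using V0(3,4) by (simp_all add: I_def not_le)
  with V0(1,2) certificate show "?Goal \<epsilon>"
    unfolding Streett_certificate_def
    by (intro exI[of _ I] exI[of _ V0] exI[of _ J] exI[of _ V] exI[of _ W] exI[of _ d] exI[of _ q])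
       simp
qed

end
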